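(* For every integer $n\ge 0$, the following Cassini-like identity holds in the ring $\mathbb{D}$ of dual numbers: $$JD_{n+2}^{(3)}JD_{n}^{(3)}-\left(JD_{n+1}^{(3)}\right)^{2}=\frac{1}{7}\left(2^{n+1}\,VD_{-(n+2)}+\left(-1+\varepsilon\left(2^{n+2}V_{-(n+2)}+1\right)\right)\right),$$ where $V_{-k}=H_{k}(2,1)$ and $VD_{-k}=V_{-k}+\varepsilon V_{-(k+1)}$ for integers $k\ge 0$.
   Context: $\mathbb{D}=\mathbb{R}[\varepsilon]=\{a+\varepsilon b: a,b\in\mathbb{R}\}$ with $\varepsilon\ne0$, $\varepsilon^2=0$, is the commutative ring of dual numbers, so $(a_1+\varepsilon b_1)(a_2+\varepsilon b_2)=a_1a_2+\varepsilon(a_1b_2+a_2b_1)$. The third order Jacobsthal numbers are defined by $J_0^{(3)}=0$, $J_1^{(3)}=J_2^{(3)}=1$, $J_{n+3}^{(3)}=J_{n+2}^{(3)}+J_{n+1}^{(3)}+2J_n^{(3)}$ for $n\ge0$. The dual third order Jacobsthal numbers are $JD_n^{(3)}=J_n^{(3)}+\varepsilon J_{n+1}^{(3)}$, $n\ge0$. For real $a,b$ and an integer $n$, $H_n(a,b)$ is the 3-periodic sequence with $H_n(a,b)=a$ if $n\equiv0\pmod 3$, $H_n(a,b)=b$ if $n\equiv1\pmod 3$, and $H_n(a,b)=-(a+b)$ if $n\equiv2\pmod 3$. *)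

theory Defs
  imports Complex_Main
begin

text \<open>The pair \<open>Dual a b\<close> stands for \<open>a + \<epsilon> b\<close>; see \<open>Dual_eq\<close> below.\<close>

datatype dual_number = Dual (std_part: real) (eps_part: real)

instantiation dual_number :: "{comm_ring_1, real_algebra_1}"
begin

definition "0 = Dual 0 0"
definition "1 = Dual 1 0"
definition "x + y = Dual (std_part x + std_part y) (eps_part x + eps_part y)"
definition "x - y = Dual (std_part x - std_part y) (eps_part x - eps_part y)"
definition "- x = Dual (- std_part x) (- eps_part x)"
definition "x * y = Dual (std_part x * std_part y)
                         (std_part x * eps_part y + std_part y * eps_part x)"
definition "r *\<^sub>R x = Dual (r * std_part x) (r * eps_part x)"

instance
  by standard
    (simp_all add: zero_dual_number_def one_dual_number_def plus_dual_number_def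
      minus_dual_number_def uminus_dual_number_def times_dual_number_def
      scaleR_dual_number_def algebra_simps)

end

definition dual_eps :: dual_number (\<open>\<epsilon>\<close>) where
  "\<epsilon> = Dual 0 1"

lemma dual_eps_nonzero: "\<epsilon> \<noteq> 0"
  by (simp add: dual_eps_def zero_dual_number_def)

lemma dual_eps_square: "\<epsilon>\<^sup>2 = 0"
  by (simp add: dual_eps_def zero_dual_number_def times_dual_number_def power2_eq_square)

lemma Dual_eq: "Dual a b = of_real a + \<epsilon> * of_real b"
  by (simp add: of_real_def dual_eps_def one_dual_number_def plus_dual_number_def
      times_dual_number_def scaleR_dual_number_def)

fun J :: "nat \<Rightarrow> nat" where
  "J 0 = 0"
| "J (Suc 0) = 1"
| "J (Suc (Suc 0)) = 1"
| "J (Suc (Suc (Suc n))) = J (Suc (Suc n)) + J (Suc n) + 2 * J n"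

definition JD :: "nat \<Rightarrow> dual_number" where
  "JD n = of_nat (J n) + \<epsilon> * of_nat (J (n + 1))"

definition H :: "int \<Rightarrow> real \<Rightarrow> real \<Rightarrow> real" where
  "H n a b = (if n mod 3 = 0 then a else if n mod 3 = 1 then b else - (a + b))"

text \<open>Only non-positive indices of \<open>V\<close> and \<open>VD\<close> are needed, so they are indexed by the
  absolute value \<open>k\<close>: \<open>V_neg k\<close> is \<open>V\<close> at \<open>-k\<close>, and \<open>VD_neg k\<close> is \<open>VD\<close> at \<open>-k\<close>.\<close>

definition V_neg :: "nat \<Rightarrow> real" where
  "V_neg k = H (int k) 2 1"

definition VD_neg :: "nat \<Rightarrow> dual_number" where
  "VD_neg k = of_real (V_neg k) + \<epsilon> * of_real (V_neg (k + 1))"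

end

theory Submission
  imports Defs
begin

text \<open>
  The characteristic polynomial \<open>x\<^sup>3 - x\<^sup>2 - x - 2 = (x - 2) (x\<^sup>2 + x + 1)\<close> has the root \<open>2\<close> and the two
  primitive cube roots of unity. Hence \<open>J n\<close> is a multiple of \<open>2 ^ n\<close> plus a 3-periodic term whose
  sum over a period vanishes; \<open>J_binet\<close> identifies this term as \<open>- V_neg (2 * n) / 7\<close>. The doubled
  index only reverses the direction of the period, since \<open>2 * n\<close> and \<open>- n\<close> agree modulo 3.

  Substituting this formula into a quadratic Cassini expression cancels the \<open>4 ^ n\<close> terms. What
  remains is \<open>2 ^ n\<close> times a linear combination of periodic terms, plus a quadratic form in them
  that is constant: two successive values \<open>u\<close>, \<open>v\<close> of \<open>V_neg (2 * n)\<close> satisfy \<open>u\<^sup>2 + u v + v\<^sup>2 = 7\<close>, which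
  accounts, after division by 7, for the constant \<open>- 1\<close> in \<open>J_cassini\<close> and \<open>1\<close> in
  \<open>J_cassini_shifted\<close>. These two real identities are 7 times the
  standard part and 7 times the \<open>\<epsilon>\<close> part of the identity over the dual numbers.
\<close>

lemma V_neg_values: "V_neg k = (if k mod 3 = 0 then 2 else if k mod 3 = 1 then 1 else - 3)"
proof -
  have "int k mod 3 = int (k mod 3)" by (simp add: zmod_int)
  then show ?thesis by (simp add: V_neg_def H_def)
qed

lemma V_neg_add_3: "V_neg (k + 3) = V_neg k"
  by (simp add: V_neg_values)

lemma V_neg_sum_period: "V_neg (k + 2) = - V_neg k - V_neg (k + 1)"
proof -
  consider "k mod 3 = 0" "(k + 1) mod 3 = 1" "(k + 2) mod 3 = 2"
    | "k mod 3 = 1" "(k + 1) mod 3 = 2" "(k + 2) mod 3 = 0"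
    | "k mod 3 = 2" "(k + 1) mod 3 = 0" "(k + 2) mod 3 = 1"
    by atomize_elim presburger
  then show ?thesis
    by cases (simp_all add: V_neg_values del: add_2_eq_Suc')
qed

lemma V_neg_double_add_3: "V_neg (2 * (n + 3)) = V_neg (2 * n)"
  using V_neg_add_3 [of "2 * n + 3"] V_neg_add_3 [of "2 * n"] by (simp add: algebra_simps)

lemma V_neg_double_sum_period: "V_neg (2 * (n + 2)) = - V_neg (2 * n) - V_neg (2 * (n + 1))"
proof -
  have "2 * (n + 2) = (2 * n + 1) + 3" "2 * (n + 1) = 2 * n + 2" by simp_all
  then have "V_neg (2 * (n + 2)) = V_neg (2 * n + 1)" "V_neg (2 * (n + 1)) = V_neg (2 * n + 2)"
    by (simp_all only: V_neg_add_3)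
  then show ?thesis using V_neg_sum_period [of "2 * n"] by simp
qed

text \<open>Both sides satisfy the recurrence: \<open>2 ^ (n + 1)\<close> because \<open>2\<close> is a root of the characteristic
  polynomial, the periodic term because it has period 3 and sums to zero over a period.\<close>

lemma J_binet: "7 * real (J n) = 2 ^ (n + 1) - V_neg (2 * n)"
proof (induction n rule: J.induct)
  case (4 n)
  then show ?case
    using V_neg_double_add_3 [of n] V_neg_double_sum_period [of n]
    by (simp add: eval_nat_numeral algebra_simps)
qed (simp_all add: V_neg_def H_def)

text \<open>This aligns the reversed periodic sequence of \<open>J_binet\<close> with the forward one on the right-hand
  sides of the Cassini identities: over the three residues of \<open>n\<close> there are only three quadruples of
  values.\<close>

lemma V_neg_reversed_cases:
  obtains "V_neg (2 * n) = 2" "V_neg (2 * (n + 1)) = -3" "V_neg (n + 2) = -3" "V_neg (n + 3) = 2"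
  | "V_neg (2 * n) = -3" "V_neg (2 * (n + 1)) = 1" "V_neg (n + 2) = 2" "V_neg (n + 3) = 1"
  | "V_neg (2 * n) = 1" "V_neg (2 * (n + 1)) = 2" "V_neg (n + 2) = 1" "V_neg (n + 3) = -3"
proof -
  consider "2 * n mod 3 = 0" "2 * (n + 1) mod 3 = 2" "(n + 2) mod 3 = 2" "(n + 3) mod 3 = 0"
    | "2 * n mod 3 = 2" "2 * (n + 1) mod 3 = 1" "(n + 2) mod 3 = 0" "(n + 3) mod 3 = 1"
    | "2 * n mod 3 = 1" "2 * (n + 1) mod 3 = 0" "(n + 2) mod 3 = 1" "(n + 3) mod 3 = 2"
    by atomize_elim presburger
  then show thesis
    by cases (rule that; simp only: V_neg_values; simp)+
qed

text \<open>The third term of each period is eliminated, so that the Cassini expressions become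
  polynomials in \<open>2 ^ n\<close> and two successive periodic terms.\<close>

lemma J_binet_shifts:
  "7 * real (J (n + 1)) = 2 ^ (n + 2) - V_neg (2 * (n + 1))"
  "7 * real (J (n + 2)) = 2 ^ (n + 3) + V_neg (2 * n) + V_neg (2 * (n + 1))"
  "7 * real (J (n + 3)) = 2 ^ (n + 4) - V_neg (2 * n)"
  using J_binet [of "n + 1"] J_binet [of "n + 2"] J_binet [of "n + 3"]
    V_neg_double_add_3 [of n] V_neg_double_sum_period [of n]
  by (simp_all add: eval_nat_numeral)

text \<open>With \<open>u = V_neg (2 * n)\<close> and \<open>v = V_neg (2 * (n + 1))\<close>, Binet's formula turns 49 times the
  Cassini expression into \<open>2 ^ (n + 1) * (5 * v - 3 * u) - (u\<^sup>2 + u * v + v\<^sup>2)\<close>. The linear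
  factor is \<open>7 * V_neg (n + 2)\<close> and the quadratic form is \<open>7\<close>, in each of the three cases.\<close>

lemma J_cassini:
  "7 * (real (J (n + 2)) * real (J n) - (real (J (n + 1)))\<^sup>2)
    = 2 ^ (n + 1) * V_neg (n + 2) - 1"
proof -
  have "49 * (real (J (n + 2)) * real (J n) - (real (J (n + 1)))\<^sup>2)
      = (7 * real (J (n + 2))) * (7 * real (J n)) - (7 * real (J (n + 1)))\<^sup>2"
    by (simp add: power2_eq_square algebra_simps)
  also have "\<dots> = 7 * (2 ^ (n + 1) * V_neg (n + 2) - 1)"
    unfolding J_binet [of n] J_binet_shifts [of n]
    by (rule V_neg_reversed_cases [of n])
      (simp_all only:, simp_all add: power_add power2_eq_square algebra_simps)
  finally show ?thesis by simp
qed

text \<open>In the \<open>\<epsilon>\<close> part of \<open>JD (n + 2) * JD n - (JD (n + 1))\<^sup>2\<close> the product \<open>J (n + 1) * J (n + 2)\<close>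
  occurs once positively and twice negatively, which leaves this expression. Here the quadratic form
  in \<open>u\<close>, \<open>v\<close> (as for \<open>J_cassini\<close>) enters with a positive sign, because \<open>V_neg (2 * n)\<close> returns to \<open>u\<close> at \<open>n + 3\<close>:
  \<open>u * u - v * (- u - v) = u\<^sup>2 + u * v + v\<^sup>2\<close>.\<close>

lemma J_cassini_shifted:
  "7 * (real (J (n + 3)) * real (J n) - real (J (n + 1)) * real (J (n + 2)))
    = 2 ^ (n + 1) * V_neg (n + 3) + 2 ^ (n + 2) * V_neg (n + 2) + 1"
proof -
  have "49 * (real (J (n + 3)) * real (J n) - real (J (n + 1)) * real (J (n + 2)))
      = (7 * real (J (n + 3))) * (7 * real (J n)) - (7 * real (J (n + 1))) * (7 * real (J (n + 2)))"
    by (simp add: algebra_simps)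
  also have "\<dots> = 7 * (2 ^ (n + 1) * V_neg (n + 3) + 2 ^ (n + 2) * V_neg (n + 2) + 1)"
    unfolding J_binet [of n] J_binet_shifts [of n]
    by (rule V_neg_reversed_cases [of n])
      (simp_all only:, simp_all add: power_add algebra_simps)
  finally show ?thesis by simp
qed

lemma JD_eq_Dual: "JD n = Dual (real (J n)) (real (J (n + 1)))"
  by (simp add: JD_def Dual_eq)

lemma VD_neg_eq_Dual: "VD_neg k = Dual (V_neg k) (V_neg (k + 1))"
  by (simp add: VD_neg_def Dual_eq)

theorem theorem2p3:
  fixes n :: nat
  shows "JD (n + 2) * JD n - (JD (n + 1))\<^sup>2 =
    (1 / 7) *\<^sub>R (2 ^ (n + 1) * VD_neg (n + 2)
      + (- 1 + \<epsilon> * (2 ^ (n + 2) * of_real (V_neg (n + 2)) + 1)))"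
proof -
  have power: "2 ^ k = Dual (2 ^ k) 0" for k
    by (simp add: Dual_eq)
  have lhs: "JD (n + 2) * JD n - (JD (n + 1))\<^sup>2 =
      Dual (real (J (n + 2)) * real (J n) - (real (J (n + 1)))\<^sup>2)
        (real (J (n + 3)) * real (J n) - real (J (n + 1)) * real (J (n + 2)))"
    by (simp add: JD_eq_Dual times_dual_number_def minus_dual_number_def power2_eq_square
        numeral_3_eq_3)
  have rhs: "2 ^ (n + 1) * VD_neg (n + 2)
        + (- 1 + \<epsilon> * (2 ^ (n + 2) * of_real (V_neg (n + 2)) + 1)) =
      Dual (2 ^ (n + 1) * V_neg (n + 2) - 1)
        (2 ^ (n + 1) * V_neg (n + 3) + 2 ^ (n + 2) * V_neg (n + 2) + 1)"
    unfolding power VD_neg_eq_Dual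
    by (simp add: of_real_def dual_eps_def one_dual_number_def plus_dual_number_def
        uminus_dual_number_def times_dual_number_def scaleR_dual_number_def eval_nat_numeral)
  show ?thesis
    unfolding lhs rhs J_cassini [symmetric] J_cassini_shifted [symmetric]
    by (simp add: scaleR_dual_number_def)
qed

end
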